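(* Let $n \ge 2$ and let $L \subset \mathbb{R}^n$ be a lattice of rank $n$. Let $x_1,\dots,x_n \in L^+$ be linearly independent vectors corresponding to the positive successive minima of $L$, i.e. $\|x_j\| = \lambda_j^+(L)$ for each $1\le j\le n$. Then each of $x_1,\dots,x_n$ is indecomposable.
   Context: $L^+ = L \cap \mathbb{R}^n_{\ge 0}$ is the set of vectors of $L$ with nonnegative coordinates. A nonzero vector $x \in L^+$ is indecomposable if there do not exist nonzero $y,z\in L^+$ with $x=y+z$. $\|\cdot\|$ is the Euclidean norm, and $\mathbb{B}_n(r)$ is the closed Euclidean ball of radius $r$ centered at the origin in $\mathbb{R}^n$. The positive successive minima of $L$ are, for $1\le j\le n$, $$\lambda^+_j(L) = \min\{ r \in \mathbb{R}_{>0} : \dim_{\mathbb{R}} \operatorname{span}_{\mathbb{R}}(\mathbb{B}_n(r)\cap L^+) \ge j\}.$$ *)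

theory Defs
  imports "HOL-Analysis.Analysis"
begin

text \<open>The ambient space is \<open>real ^ 'n\<close> with its Euclidean norm, and \<open>n = CARD('n)\<close>.\<close>

text \<open>A lattice of rank \<open>k\<close> is the set of integer combinations of \<open>k\<close> vectors that are
  linearly independent over the reals. Independence already makes \<open>B\<close> finite.\<close>

definition lattice_of_rank :: "nat \<Rightarrow> (real ^ 'n) set \<Rightarrow> bool" where
  "lattice_of_rank k L \<longleftrightarrow>
     (\<exists>B. independent B \<and> card B = k \<and>
          L = {v. \<exists>c :: real ^ 'n \<Rightarrow> int. v = (\<Sum>b\<in>B. of_int (c b) *\<^sub>R b)})"

definition pos_part :: "(real ^ 'n) set \<Rightarrow> (real ^ 'n) set" where
  "pos_part L = {x \<in> L. \<forall>i. 0 \<le> x $ i}"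

definition indecomposable :: "(real ^ 'n) set \<Rightarrow> real ^ 'n \<Rightarrow> bool" where
  "indecomposable L x \<longleftrightarrow>
     x \<in> pos_part L \<and> x \<noteq> 0 \<and>
     \<not> (\<exists>y z. y \<in> pos_part L \<and> y \<noteq> 0 \<and> z \<in> pos_part L \<and> z \<noteq> 0 \<and> x = y + z)"

text \<open>The operator \<open>LEAST\<close> is the minimum of an infinite set of reals whenever that minimum is
  attained, and is unspecified otherwise. For a lattice of rank \<open>n\<close> and \<open>1 \<le> j \<le> n\<close> it is
  attained, since \<open>pos_part L\<close> spans the whole space and \<open>L\<close> meets every ball in a finite set.\<close>

definition pos_succ_min :: "(real ^ 'n) set \<Rightarrow> nat \<Rightarrow> real" where
  "pos_succ_min L j = (LEAST r. 0 < r \<and> j \<le> dim (span (cball 0 r \<inter> pos_part L)))"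

end

theory Submission
  imports Defs
begin

text \<open>
  Write \<open>\<lambda> k\<close> for \<open>pos_succ_min L k\<close>, and suppose that \<open>x j = y + z\<close> with nonzero \<open>y\<close>
  and \<open>z\<close> in the positive part. Nonnegative vectors have a nonnegative inner product, so both summands are strictly shorter than \<open>x j\<close>.
  Let \<open>i\<close> be the first index with \<open>\<lambda> i = \<lambda> j\<close>. Since \<open>\<lambda>\<close> is monotone, the vectors
  \<open>x 1\<close>, ..., \<open>x (i - 1)\<close> are also strictly shorter than \<open>x j\<close>, so some ball of radius
  \<open>r < \<lambda> i = \<lambda> j\<close> contains all of them together with \<open>y\<close> and \<open>z\<close>. By minimality of \<open>\<lambda> i\<close>, the
  positive lattice vectors in this ball span at most \<open>i - 1\<close> dimensions, a dimension that
  \<open>x 1\<close>, ..., \<open>x (i - 1)\<close> already exhaust. So \<open>y\<close> and \<open>z\<close>, hence also \<open>x j\<close>, lie in the span of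
  \<open>x 1\<close>, ..., \<open>x (i - 1)\<close>, which contradicts linear independence because \<open>j \<ge> i\<close>.

  Minimality can only be used if the minimum that defines \<open>\<lambda> i\<close> is attained. This follows from
  the discreteness of the lattice (\<open>lattice_finite_in_ball\<close>, \<open>pos_succ_min_attained\<close>) and from
  the \<open>x k\<close> themselves, which witness that some ball reaches each dimension up to \<open>CARD('n)\<close>.
\<close>

text \<open>Each coordinate with respect to independent vectors extends to a linear functional on
  the whole space, which is bounded because the dimension is finite. So only finitely
  many integers can occur as a coordinate of a lattice vector in a given ball.\<close>

lemma lattice_finite_in_ball:
  fixes L :: "(real ^ 'n) set"
  assumes "lattice_of_rank k L"
  shows "finite (cball 0 R \<inter> L)"
proof -
  obtain B where B: "independent B"
    and L: "L = {v. \<exists>c :: real ^ 'n \<Rightarrow> int. v = (\<Sum>b\<in>B. of_int (c b) *\<^sub>R b)}"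
    using assms unfolding lattice_of_rank_def by blast
  have finB: "finite B"
    using B by (rule independent_imp_finite)
  have coord: "\<exists>K. \<forall>c :: real ^ 'n \<Rightarrow> int. norm (\<Sum>b\<in>B. of_int (c b) *\<^sub>R b) \<le> R \<longrightarrow>
      \<bar>real_of_int (c b)\<bar> \<le> K" if b: "b \<in> B" for b
  proof -
    obtain g :: "real ^ 'n \<Rightarrow> real" where lin: "linear g"
      and g: "\<And>b'. b' \<in> B \<Longrightarrow> g b' = (if b' = b then 1 else 0)"
      using linear_independent_extend[OF B, of "\<lambda>b'. if b' = b then 1 else 0"] by blast
    obtain K where K: "0 < K" "\<And>v. norm (g v) \<le> K * norm v"
      using linear_bounded_pos[OF lin] by (metis mult.commute)
    have val: "g (\<Sum>b\<in>B. of_int (c b) *\<^sub>R b) = of_int (c b)" for c :: "real ^ 'n \<Rightarrow> int"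
    proof -
      have "g (\<Sum>b\<in>B. of_int (c b) *\<^sub>R b) = (\<Sum>b'\<in>B. of_int (c b') * g b')"
        by (simp add: linear_sum[OF lin] linear_scale[OF lin])
      also have "\<dots> = (\<Sum>b'\<in>B. if b' = b then of_int (c b') else 0)"
        by (rule sum.cong) (auto simp: g)
      also have "\<dots> = of_int (c b)"
        using b finB by simp
      finally show ?thesis .
    qed
    have "\<bar>real_of_int (c b)\<bar> \<le> K * R"
      if "norm (\<Sum>b\<in>B. of_int (c b) *\<^sub>R b) \<le> R" for c :: "real ^ 'n \<Rightarrow> int"
    proof -
      have "\<bar>real_of_int (c b)\<bar> \<le> K * norm (\<Sum>b\<in>B. of_int (c b) *\<^sub>R b)"
        using K(2)[of "\<Sum>b\<in>B. of_int (c b) *\<^sub>R b"] by (simp only: val real_norm_def)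
      also have "\<dots> \<le> K * R"
        using that K(1) by simp
      finally show ?thesis .
    qed
    then show ?thesis by blast
  qed
  obtain K where K: "\<And>b c. b \<in> B \<Longrightarrow> norm (\<Sum>b\<in>B. of_int (c b :: int) *\<^sub>R b) \<le> R \<Longrightarrow>
      \<bar>real_of_int (c b)\<bar> \<le> K b"
    using coord by metis
  let ?I = "\<lambda>b. {-\<lceil>K b\<rceil>..\<lceil>K b\<rceil>}"
  have "cball 0 R \<inter> L \<subseteq> (\<lambda>c. \<Sum>b\<in>B. of_int (c b) *\<^sub>R b) ` PiE B ?I"
  proof
    fix v assume v: "v \<in> cball 0 R \<inter> L"
    then obtain c :: "real ^ 'n \<Rightarrow> int" where c: "v = (\<Sum>b\<in>B. of_int (c b) *\<^sub>R b)"
      using L by blast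
    have "c b \<in> ?I b" if "b \<in> B" for b
    proof -
      have "\<bar>real_of_int (c b)\<bar> \<le> K b"
        using K[OF that, of c] v c by simp
      then show ?thesis by (auto simp: abs_le_iff) linarith+
    qed
    then have "restrict c B \<in> PiE B ?I"
      by simp
    moreover have "v = (\<Sum>b\<in>B. of_int (restrict c B b) *\<^sub>R b)"
      unfolding c by (rule sum.cong) auto
    ultimately show "v \<in> (\<lambda>c. \<Sum>b\<in>B. of_int (c b) *\<^sub>R b) ` PiE B ?I"
      by blast
  qed
  moreover have "finite (PiE B ?I)"
    using finB by (intro finite_PiE) auto
  ultimately show ?thesis
    by (meson finite_imageI finite_subset)
qed

text \<open>Shrinking a ball until its boundary meets the longest of its finitely many positive
  lattice vectors does not change the span. So only the norms of these vectors, a finite set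
  once a radius \<open>R\<close> is known to suffice, compete for the minimum.\<close>

lemma pos_succ_min_attained:
  fixes L :: "(real ^ 'n) set"
  assumes lat: "lattice_of_rank k L" and j: "1 \<le> j"
    and R: "j \<le> dim (span (cball 0 R \<inter> pos_part L))"
  shows "0 < pos_succ_min L j"
    and "j \<le> dim (span (cball 0 (pos_succ_min L j) \<inter> pos_part L))"
    and "\<And>r. j \<le> dim (span (cball 0 r \<inter> pos_part L)) \<Longrightarrow> pos_succ_min L j \<le> r"
proof -
  define P where "P r \<longleftrightarrow> 0 < r \<and> j \<le> dim (span (cball 0 r \<inter> pos_part L))" for r
  define N where "N = norm ` (cball 0 R \<inter> pos_part L)"
  have fin: "finite (cball 0 r \<inter> pos_part L)" for r
    using lattice_finite_in_ball[OF lat, of r]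
    by (rule rev_finite_subset) (auto simp: pos_part_def)
  have shrink: "\<exists>s\<in>norm ` (cball 0 r \<inter> pos_part L). s \<le> r \<and> P s"
    if r: "j \<le> dim (span (cball 0 r \<inter> pos_part L))" for r
  proof -
    let ?C = "cball 0 r \<inter> pos_part L"
    have "\<not> ?C \<subseteq> {0}"
    proof
      assume "?C \<subseteq> {0}"
      then have "dim ?C = 0"
        by (simp only: dim_eq_0)
      then show False using r j unfolding dim_span by linarith
    qed
    then obtain w where w: "w \<in> ?C" "w \<noteq> 0" by blast
    define s where "s = Max (norm ` ?C)"
    have s: "s \<in> norm ` ?C"
      unfolding s_def using fin w by (intro Max_in) auto
    have le: "norm v \<le> s" if "v \<in> ?C" for v
      unfolding s_def using fin that by (intro Max_ge) auto
    have "s \<le> r" using s by auto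
    then have "cball 0 s \<inter> pos_part L = ?C" using le by auto
    moreover have "0 < s" using le[OF w(1)] w(2) by (smt (verit) zero_less_norm_iff)
    ultimately have "P s" using r by (simp add: P_def)
    then show ?thesis using s \<open>s \<le> r\<close> by blast
  qed
  define F where "F = {s \<in> N. P s}"
  have finF: "finite F" using fin by (simp add: F_def N_def)
  have F_ne: "F \<noteq> {}" using shrink[OF R] by (auto simp: F_def N_def)
  have m: "P (Min F)" using Min_in[OF finF F_ne] by (simp add: F_def)
  have m_le: "Min F \<le> r" if r: "j \<le> dim (span (cball 0 r \<inter> pos_part L))" for r
  proof (cases "r \<le> R")
    case True
    then have "cball 0 r \<inter> pos_part L \<subseteq> cball 0 R \<inter> pos_part L" by auto
    then obtain s where "s \<in> F" "s \<le> r"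
      using shrink[OF r] unfolding F_def N_def by blast
    then show ?thesis using Min_le[OF finF] by (meson order_trans)
  next
    case False
    obtain s where "s \<in> F" "s \<le> R"
      using shrink[OF R] unfolding F_def N_def by blast
    then show ?thesis using Min_le[OF finF] False by (smt (verit))
  qed
  have eq: "pos_succ_min L j = Min F"
    unfolding pos_succ_min_def P_def[symmetric]
    by (rule Least_equality) (use m m_le P_def in auto)
  show "0 < pos_succ_min L j"
    and "j \<le> dim (span (cball 0 (pos_succ_min L j) \<inter> pos_part L))"
    using m by (auto simp: eq P_def)
  show "\<And>r. j \<le> dim (span (cball 0 r \<inter> pos_part L)) \<Longrightarrow> pos_succ_min L j \<le> r"
    using m_le by (simp add: eq)
qed

lemma norm_less_add_nonneg:
  fixes y z :: "real ^ 'n"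
  assumes "\<And>i. 0 \<le> y $ i" "\<And>i. 0 \<le> z $ i" "z \<noteq> 0"
  shows "norm y < norm (y + z)"
proof -
  have "0 \<le> y \<bullet> z"
    by (simp add: inner_vec_def sum_nonneg assms)
  moreover have "(norm (y + z))\<^sup>2 = (norm y)\<^sup>2 + 2 * (y \<bullet> z) + (norm z)\<^sup>2"
    by (simp add: power2_norm_eq_inner inner_add_left inner_add_right inner_commute)
  moreover have "0 < (norm z)\<^sup>2"
    using assms(3) by simp
  ultimately have "(norm y)\<^sup>2 < (norm (y + z))\<^sup>2"
    by linarith
  then show ?thesis
    by (rule power2_less_imp_less) simp
qed

theorem lemma2p6:
  fixes L :: "(real ^ 'n) set" and x :: "nat \<Rightarrow> real ^ 'n"
  assumes "2 \<le> CARD('n)"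
    and "lattice_of_rank CARD('n) L"
    and "\<And>j. j \<in> {1..CARD('n)} \<Longrightarrow> x j \<in> pos_part L"
    and "inj_on x {1..CARD('n)}" and "independent (x ` {1..CARD('n)})"
    and "\<And>j. j \<in> {1..CARD('n)} \<Longrightarrow> norm (x j) = pos_succ_min L j"
  shows "\<forall>j\<in>{1..CARD('n)}. indecomposable L (x j)"
proof
  note pos = assms(3) and inj = assms(4) and indep = assms(5) and norm_x = assms(6)
  fix j assume j: "j \<in> {1..CARD('n)}"
  let ?l = "pos_succ_min L"
  define R where "R = Max (norm ` x ` {1..CARD('n)})"
  have "x ` {1..CARD('n)} \<subseteq> cball 0 R \<inter> pos_part L"
    using pos by (auto simp: R_def)
  then have "card (x ` {1..CARD('n)}) \<le> dim (cball 0 R \<inter> pos_part L)"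
    using indep by (rule independent_card_le_dim)
  then have dimR: "CARD('n) \<le> dim (span (cball 0 R \<inter> pos_part L))"
    unfolding card_image[OF inj] by simp
  have R: "k \<le> dim (span (cball 0 R \<inter> pos_part L))" if "k \<in> {1..CARD('n)}" for k
    using that dimR by simp
  have l_dim: "k \<le> dim (span (cball 0 (?l k) \<inter> pos_part L))" if "k \<in> {1..CARD('n)}" for k
    using pos_succ_min_attained(2)[OF assms(2) _ R[OF that]] that by simp
  have l_le: "?l k \<le> r"
    if "k \<in> {1..CARD('n)}" "k \<le> dim (span (cball 0 r \<inter> pos_part L))" for k r
    using pos_succ_min_attained(3)[OF assms(2) _ R[OF that(1)] that(2)] that(1) by simp
  have mono: "?l a \<le> ?l b" if "a \<in> {1..CARD('n)}" "b \<in> {1..CARD('n)}" "a \<le> b" for a b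
    using l_le[OF that(1)] l_dim[OF that(2)] that(3) by (meson order_trans)

  have "x j \<noteq> 0"
    using indep j by (metis dependent_zero imageI)
  moreover have False
    if y: "y \<in> pos_part L" "y \<noteq> 0" and z: "z \<in> pos_part L" "z \<noteq> 0" and sum: "x j = y + z"
    for y z
  proof -
    have ny: "norm y < ?l j"
      using norm_less_add_nonneg[of y z] y z sum norm_x[OF j] by (auto simp: pos_part_def)
    have nz: "norm z < ?l j"
      using norm_less_add_nonneg[of z y] y z sum norm_x[OF j]
      by (auto simp: pos_part_def add.commute)
    define i where "i = (LEAST i. i \<in> {1..CARD('n)} \<and> ?l i = ?l j)"
    have i: "i \<in> {1..CARD('n)}" "?l i = ?l j"
      using LeastI[of "\<lambda>i. i \<in> {1..CARD('n)} \<and> ?l i = ?l j" j] j unfolding i_def by auto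
    have ij: "i \<le> j"
      unfolding i_def using j by (intro Least_le) auto
    have below: "?l k < ?l j" if "k \<in> {1..<i}" for k
    proof -
      have k: "k \<in> {1..CARD('n)}" using that i by auto
      have "?l k \<noteq> ?l j"
        using not_less_Least[of k "\<lambda>i. i \<in> {1..CARD('n)} \<and> ?l i = ?l j"] that k
        unfolding i_def[symmetric] by auto
      then show ?thesis using mono[OF k j] that ij by auto
    qed
    define T where "T = x ` {1..<i}"
    have sub: "{1..<i} \<subseteq> {1..CARD('n)}" using i by auto
    have indT: "independent T"
      using independent_mono[OF indep] sub unfolding T_def by blast
    have cardT: "card T = i - 1"
      unfolding T_def using card_image[OF inj_on_subset[OF inj sub]] by simp
    define r where "r = Max (norm ` ({y, z} \<union> T))"
    have "norm v < ?l i" if "v \<in> {y, z} \<union> T" for v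
      using that ny nz below norm_x sub i(2) unfolding T_def by force
    then have r: "r < ?l i"
      unfolding r_def by (subst Max_less_iff) (auto simp: T_def)
    let ?C = "cball 0 r \<inter> pos_part L"
    have "norm v \<le> r" if "v \<in> {y, z} \<union> T" for v
      unfolding r_def by (rule Max_ge) (use that T_def in auto)
    then have "{y, z} \<union> T \<subseteq> cball 0 r"
      by (simp add: subset_iff)
    moreover have "{y, z} \<union> T \<subseteq> pos_part L"
      using y z pos sub by (auto simp: T_def)
    ultimately have C: "{y, z} \<union> T \<subseteq> ?C"
      by blast
    have "dim ?C \<le> card T"
      using l_le[OF i(1), of r] r cardT by fastforce
    then have "?C \<subseteq> span T"
      using C indT by (intro card_ge_dim_independent) auto
    then have "x j \<in> span T"
      using C unfolding sum by (intro span_add) auto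
    moreover have "T \<subseteq> x ` {1..CARD('n)} - {x j}"
      using inj sub ij j unfolding T_def inj_on_def by fastforce
    ultimately have "x j \<in> span (x ` {1..CARD('n)} - {x j})"
      using span_mono by blast
    then show False
      using indep j unfolding dependent_def by blast
  qed
  ultimately show "indecomposable L (x j)"
    unfolding indecomposable_def using pos[OF j] by blast
qed

end
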